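(* Let $q\ge 0$ and $t\ge 1$ be integers and $k\ge 1$. Then the order of the critical group of the $(q,t)$-wheel graph satisfies $$\big|K(W_k(q,t))\big| = -N_k(q,-t),$$ where $N_k(q,x)$ is the polynomial defined in the context.
   Context: The $(q,t)$-wheel graph $W_k(q,t)$ is the directed multigraph with a hub $v_0$ and rim vertices $v_1,\dots,v_k$ in clockwise order (rim indices taken modulo $k$), having $t$ edges from $v_0$ to $v_i$ and $t$ edges from $v_i$ to $v_0$ for each $i$, one edge from $v_i$ to $v_{i-1}$ and $q$ edges from $v_i$ to $v_{i+1}$ for each $i$. Its critical group (with bank vertex $v_0$) $K(W_k(q,t))$ is the group of critical configurations of the dollar game on this graph; it is isomorphic to $\mathbb{Z}^k/\overline{M}_k\mathbb{Z}^k$, where $\overline{M}_k$ is the reduced Laplacian: $\overline{M}_1=[t]$, $\overline{M}_2=\begin{pmatrix}1+q+t&-1-q\\-1-q&1+q+t\end{pmatrix}$, and for $k\ge3$, $\overline{M}_k$ is the $k\times k$ matrix with diagonal entries $1+q+t$, entries $(i,i+1 \bmod k)$ equal to $-q$, entries $(i,i-1\bmod k)$ equal to $-1$, and all other entries $0$. For an elliptic curve $E$ over $\mathbb{F}_q$ with $N_1=\#E(\mathbb{F}_q)$, the numbers $N_k=\#E(\mathbb{F}_{q^k})$ are given by a bivariate integer polynomial $N_k(q,N_1)$, determined by $\exp\big(\sum_{k\ge1} N_k T^k/k\big)=\frac{1-(1+q-N_1)T+qT^2}{(1-T)(1-qT)}$; equivalently $N_k(q,x)=1+q^k-\alpha^k-\beta^k$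 where $\alpha+\beta=1+q-x$ and $\alpha\beta=q$. *)

theory Defs
  imports
    "Graph_Theory.Digraph"
    "HOL-Algebra.Coset"
    "HOL-Computational_Algebra.Computational_Algebra"
begin

section \<open>The dollar game on a directed multigraph with a bank vertex\<close>

definition num_arcs :: "('a, 'b) pre_digraph \<Rightarrow> 'a \<Rightarrow> 'a \<Rightarrow> nat" where
  "num_arcs G u v = card {e \<in> arcs G. tail G e = u \<and> head G e = v}"

text \<open>
  A configuration is a function on all of \<open>'a\<close>; requiring the value \<open>0\<close> outside of the vertex set
  makes it determined by its values on the vertices, so that configurations can be counted.
\<close>

definition config :: "('a, 'b) pre_digraph \<Rightarrow> 'a \<Rightarrow> ('a \<Rightarrow> int) \<Rightarrow> bool" where
  "config G b c \<longleftrightarrow>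
     (\<forall>v \<in> verts G - {b}. c v \<ge> 0) \<and>
     c b = - (\<Sum>v \<in> verts G - {b}. c v) \<and>
     (\<forall>v. v \<notin> verts G \<longrightarrow> c v = 0)"

definition stable :: "('a, 'b) pre_digraph \<Rightarrow> 'a \<Rightarrow> ('a \<Rightarrow> int) \<Rightarrow> bool" where
  "stable G b c \<longleftrightarrow> (\<forall>v \<in> verts G - {b}. c v < int (out_degree G v))"

text \<open>
  One dollar is sent along every arc leaving \<open>u\<close>. A loop at \<open>u\<close> counts towards the out-degree and
  returns its dollar to \<open>u\<close>.
\<close>

definition fire :: "('a, 'b) pre_digraph \<Rightarrow> 'a \<Rightarrow> ('a \<Rightarrow> int) \<Rightarrow> ('a \<Rightarrow> int)" where
  "fire G u c = (\<lambda>v. c v - (if v = u then int (out_degree G u) else 0) + int (num_arcs G u v))"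

text \<open>The bank may go into debt, but it may fire only if no other vertex can.\<close>

definition can_fire :: "('a, 'b) pre_digraph \<Rightarrow> 'a \<Rightarrow> ('a \<Rightarrow> int) \<Rightarrow> 'a \<Rightarrow> bool" where
  "can_fire G b c u \<longleftrightarrow>
     u \<in> verts G \<and> (if u = b then stable G b c else c u \<ge> int (out_degree G u))"

definition fire_step :: "('a, 'b) pre_digraph \<Rightarrow> 'a \<Rightarrow> ('a \<Rightarrow> int) \<Rightarrow> ('a \<Rightarrow> int) \<Rightarrow> bool" where
  "fire_step G b c d \<longleftrightarrow> (\<exists>u. can_fire G b c u \<and> d = fire G u c)"

definition recurrent :: "('a, 'b) pre_digraph \<Rightarrow> 'a \<Rightarrow> ('a \<Rightarrow> int) \<Rightarrow> bool" where
  "recurrent G b c \<longleftrightarrow> (fire_step G b)\<^sup>+\<^sup>+ c c"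

definition critical :: "('a, 'b) pre_digraph \<Rightarrow> 'a \<Rightarrow> ('a \<Rightarrow> int) \<Rightarrow> bool" where
  "critical G b c \<longleftrightarrow> config G b c \<and> stable G b c \<and> recurrent G b c"

definition critical_of :: "('a, 'b) pre_digraph \<Rightarrow> 'a \<Rightarrow> ('a \<Rightarrow> int) \<Rightarrow> ('a \<Rightarrow> int)" where
  "critical_of G b c = (THE d. critical G b d \<and> (fire_step G b)\<^sup>*\<^sup>* c d)"

definition critical_group :: "('a, 'b) pre_digraph \<Rightarrow> 'a \<Rightarrow> ('a \<Rightarrow> int) monoid" where
  "critical_group G b =
     \<lparr> carrier = {c. critical G b c},
       monoid.mult = (\<lambda>c d. critical_of G b (\<lambda>v. c v + d v)),
       one = critical_of G b (\<lambda>_. 0) \<rparr>"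


section \<open>The wheel graphs\<close>

text \<open>
  The hub is vertex \<open>0\<close>, the rim vertices are \<open>1, \<dots>, k\<close>. The second argument of the constructors
  numbers parallel arcs.
\<close>

datatype wheel_arc =
    From_Hub nat nat
  | To_Hub nat nat
  | Backward nat
  | Forward nat nat

definition rim_next :: "nat \<Rightarrow> nat \<Rightarrow> nat" where
  "rim_next k i = (if i = k then 1 else i + 1)"

definition rim_prev :: "nat \<Rightarrow> nat \<Rightarrow> nat" where
  "rim_prev k i = (if i = 1 then k else i - 1)"

definition wheel :: "nat \<Rightarrow> nat \<Rightarrow> nat \<Rightarrow> (nat, wheel_arc) pre_digraph" where
  "wheel k q t =
     \<lparr> verts = {0..k},
       arcs = {From_Hub i j | i j. i \<in> {1..k} \<and> j < t}
            \<union> {To_Hub i j | i j. i \<in> {1..k} \<and> j < t}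
            \<union> {Backward i | i. i \<in> {1..k}}
            \<union> {Forward i j | i j. i \<in> {1..k} \<and> j < q},
       tail = (\<lambda>e. case e of
                From_Hub i j \<Rightarrow> 0 | To_Hub i j \<Rightarrow> i | Backward i \<Rightarrow> i | Forward i j \<Rightarrow> i),
       head = (\<lambda>e. case e of
                From_Hub i j \<Rightarrow> i | To_Hub i j \<Rightarrow> 0
              | Backward i \<Rightarrow> rim_prev k i | Forward i j \<Rightarrow> rim_next k i) \<rparr>"


section \<open>The polynomials counting points on elliptic curves\<close>

text \<open>
  A polynomial in \<open>q\<close> and \<open>x\<close> is represented as a polynomial in \<open>x\<close> whose coefficients are
  polynomials in \<open>q\<close>.
\<close>

definition eval2 :: "int poly poly \<Rightarrow> 'a \<Rightarrow> 'a \<Rightarrow> 'a :: comm_ring_1" where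
  "eval2 P q x = poly (map_poly (\<lambda>c. poly (map_poly of_int c) q) P) x"

definition curve_zeta :: "rat \<Rightarrow> rat \<Rightarrow> rat fps" where
  "curve_zeta q x =
     (1 - fps_const (1 + q - x) * fps_X + fps_const q * fps_X ^ 2) /
     ((1 - fps_X) * (1 - fps_const q * fps_X))"

text \<open>
  The identity of power series over all rational \<open>q\<close> and \<open>x\<close> is the formal one, as a polynomial is
  determined by its values on an infinite field. In the series the term for \<open>k = 0\<close>
  vanishes because of \<open>y / 0 = 0\<close>; it puts no constraint on \<open>N 0\<close>, which is normalised to \<open>0\<close>.
\<close>

definition is_point_count_poly :: "(nat \<Rightarrow> int poly poly) \<Rightarrow> bool" where
  "is_point_count_poly N \<longleftrightarrow> N 0 = 0 \<and>
     (\<forall>q x. fps_exp 1 oo Abs_fps (\<lambda>k. eval2 (N k) q x / of_nat k) = curve_zeta q x)"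

definition N_poly :: "nat \<Rightarrow> int poly poly" where
  "N_poly = (THE N. is_point_count_poly N)"


subsection \<open>Well-definedness\<close>

lemma map_poly_hom_add:
  assumes "h 0 = 0" "\<And>a b. h (a + b) = h a + h b"
  shows "map_poly h (p + r) = map_poly h p + map_poly h r"
  by (rule poly_eqI) (simp add: coeff_map_poly assms)

lemma map_poly_hom_mult:
  fixes h :: "'a::comm_ring_1 \<Rightarrow> 'b::comm_ring_1"
  assumes "h 0 = 0" "\<And>a b. h (a + b) = h a + h b" "\<And>a b. h (a * b) = h a * h b"
  shows "map_poly h (p * r) = map_poly h p * map_poly h r"
proof -
  have *: "h (sum f A) = (\<Sum>x\<in>A. h (f x))" for f :: "nat \<Rightarrow> 'a" and A
    by (induction A rule: infinite_finite_induct) (auto simp: assms)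
  show ?thesis
    by (rule poly_eqI) (simp add: coeff_map_poly assms coeff_mult *)
qed

lemma eval2_inner_hom:
  fixes q :: "'a :: comm_ring_1"
  defines "h \<equiv> (\<lambda>c :: int poly. poly (map_poly of_int c) q)"
  shows "h 0 = 0" "h 1 = 1" "h (a + b) = h a + h b" "h (a * b) = h a * h b"
  unfolding h_def
  by (simp_all add: map_poly_hom_add map_poly_hom_mult)

lemma eval2_add: "eval2 (P + R) q x = eval2 P q x + eval2 R q x"
  unfolding eval2_def by (subst map_poly_hom_add) (simp_all add: eval2_inner_hom)

lemma eval2_mult: "eval2 (P * R) q x = eval2 P q x * eval2 R q x"
  unfolding eval2_def by (subst map_poly_hom_mult) (simp_all add: eval2_inner_hom)

lemma eval2_0 [simp]: "eval2 0 q x = 0"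
  by (simp add: eval2_def)

lemma eval2_1 [simp]: "eval2 1 q x = 1"
  by (simp add: eval2_def eval2_inner_hom)

lemma eval2_uminus: "eval2 (- P) q x = - eval2 P q x"
  using eval2_add[of P "- P" q x] by (simp add: eq_neg_iff_add_eq_0 add.commute)

lemma eval2_diff: "eval2 (P - R) q x = eval2 P q x - eval2 R q x"
  using eval2_add[of P "- R" q x] by (simp add: eval2_uminus)

lemma eval2_power: "eval2 (P ^ n) q x = eval2 P q x ^ n"
  by (induction n) (simp_all add: eval2_mult)

lemma eval2_var_q: "eval2 [:[:0, 1:]:] q x = q"
  by (simp add: eval2_def map_poly_pCons)

lemma eval2_var_x: "eval2 [:0, 1:] q x = x"
  by (simp add: eval2_def map_poly_pCons eval2_inner_hom)

lemma eval2_2: "eval2 2 q x = 2"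
  using eval2_add[of 1 1 q x] by simp

lemma eval2_smult_q: "eval2 (smult [:0, 1:] P) q x = q * eval2 P q x"
  using eval2_mult[of "[:[:0, 1:]:]" P q x] by (simp add: eval2_var_q)

lemmas eval2_hom = eval2_add eval2_mult eval2_uminus eval2_diff eval2_power eval2_var_q eval2_var_x
  eval2_2 eval2_smult_q

lemma eval2_rat_eqI:
  assumes "\<And>q x :: rat. eval2 P q x = eval2 R q x"
  shows "P = R"
proof (rule poly_eqI)
  fix i
  have "map_poly (\<lambda>c. poly (map_poly of_int c) q) P = map_poly (\<lambda>c. poly (map_poly of_int c) q) R"
    for q :: rat
    using assms[of q] by (simp add: eval2_def poly_eq_poly_eq_iff[symmetric] fun_eq_iff)
  hence "coeff (map_poly (\<lambda>c. poly (map_poly of_int c) q) P) i =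
         coeff (map_poly (\<lambda>c. poly (map_poly of_int c) q) R) i" for q :: rat
    by simp
  hence "poly (map_poly of_int (coeff P i)) q = poly (map_poly of_int (coeff R i)) q" for q :: rat
    by (simp add: coeff_map_poly)
  hence *: "map_poly of_int (coeff P i) = (map_poly of_int (coeff R i) :: rat poly)"
    by (simp add: poly_eq_poly_eq_iff[symmetric] fun_eq_iff)
  show "coeff P i = coeff R i"
  proof (rule poly_eqI)
    fix j
    have "coeff (map_poly of_int (coeff P i)) j = (coeff (map_poly of_int (coeff R i)) j :: rat)"
      using * by simp
    thus "coeff (coeff P i) j = coeff (coeff R i) j"
      by (simp add: coeff_map_poly)
  qed
qed

fun trace_poly :: "nat \<Rightarrow> int poly poly" where
  "trace_poly 0 = 1 + 1"
| "trace_poly (Suc 0) = 1 + [:[:0, 1:]:] - [:0, 1:]"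
| "trace_poly (Suc (Suc k)) =
     (1 + [:[:0, 1:]:] - [:0, 1:]) * trace_poly (Suc k) - [:[:0, 1:]:] * trace_poly k"

lemma eval2_trace_poly:
  assumes "\<alpha> + \<beta> = 1 + q - x" "\<alpha> * \<beta> = q"
  shows "eval2 (trace_poly k) q x = \<alpha> ^ k + \<beta> ^ k"
proof (induction k rule: trace_poly.induct)
  case (3 k)
  have "eval2 (trace_poly (Suc (Suc k))) q x =
        (\<alpha> + \<beta>) * (\<alpha> ^ Suc k + \<beta> ^ Suc k) - \<alpha> * \<beta> * (\<alpha> ^ k + \<beta> ^ k)"
    unfolding trace_poly.simps eval2_hom 3 eval2_1 assms(1)[symmetric] assms(2) ..
  also have "\<dots> = \<alpha> ^ Suc (Suc k) + \<beta> ^ Suc (Suc k)"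
    by (simp add: algebra_simps)
  finally show ?case .
qed (use assms in \<open>simp_all add: eval2_hom\<close>)

lemma fps_log_deriv_quadratic:
  fixes s :: "nat \<Rightarrow> 'a :: field_char_0"
  assumes "s 0 = 2" "s 1 = a" "\<And>k. s (Suc (Suc k)) = a * s (Suc k) - b * s k"
  shows "Abs_fps (\<lambda>k. s (Suc k)) * (1 - fps_const a * fps_X + fps_const b * fps_X ^ 2) =
         - fps_deriv (1 - fps_const a * fps_X + fps_const b * fps_X ^ 2)"
proof (rule fps_ext)
  fix n
  let ?S = "Abs_fps (\<lambda>k. s (Suc k))"
  have eq: "?S * (1 - fps_const a * fps_X + fps_const b * fps_X ^ 2) =
        ?S - fps_const a * (?S * fps_X) + fps_const b * (?S * fps_X ^ 2)"
    by (simp add: algebra_simps)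
  have d: "fps_deriv (1 - fps_const a * fps_X + fps_const b * fps_X ^ 2) =
        - fps_const a + fps_const (2 * b) * fps_X"
    by (simp add: fps_eq_iff fps_X_power_nth)
  have x2: "(?S * fps_X ^ 2) $ n = (if n < 2 then 0 else s (Suc (n - 2)))"
    by (simp add: fps_X_power_mult_right_nth)
  consider "n = 0" | "n = 1" | m where "n = Suc (Suc m)"
    by (metis One_nat_def not0_implies_Suc)
  thus "(?S * (1 - fps_const a * fps_X + fps_const b * fps_X ^ 2)) $ n =
        (- fps_deriv (1 - fps_const a * fps_X + fps_const b * fps_X ^ 2)) $ n"
    unfolding eq d
    using assms x2 by cases simp_all
qed

lemma fps_ode_unique:
  fixes Y Z G :: "'a :: field_char_0 fps"
  assumes "fps_deriv Y = G * Y" "fps_deriv Z = G * Z" "Y $ 0 = Z $ 0"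
  shows "Y = Z"
proof (rule fps_ext)
  fix n show "Y $ n = Z $ n"
  proof (induction n rule: less_induct)
    case (less n)
    show ?case
    proof (cases n)
      case 0
      thus ?thesis using assms by simp
    next
      case (Suc m)
      have "of_nat (Suc m) * Y $ Suc m = (G * Y) $ m"
        using arg_cong[OF assms(1), of "\<lambda>f. f $ m"] by simp
      also have "\<dots> = (G * Z) $ m"
        unfolding fps_mult_nth by (intro sum.cong) (use less Suc in auto)
      also have "\<dots> = of_nat (Suc m) * Z $ Suc m"
        using arg_cong[OF assms(2), of "\<lambda>f. f $ m"] by simp
      finally show ?thesis
        using Suc by (simp del: of_nat_Suc)
    qed
  qed
qed

lemma fps_exp_compose_eq_iff:
  fixes F Z :: "'a :: field_char_0 fps"
  assumes "F $ 0 = 0"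
  shows "fps_exp 1 oo F = Z \<longleftrightarrow> fps_deriv Z = fps_deriv F * Z \<and> Z $ 0 = 1"
proof -
  have d: "fps_deriv (fps_exp 1 oo F) = fps_deriv F * (fps_exp 1 oo F)"
    by (subst fps_compose_deriv[OF assms]) (simp add: mult.commute)
  have 0: "(fps_exp 1 oo F) $ 0 = 1"
    by simp
  show ?thesis
    using d 0 fps_ode_unique[of "fps_exp 1 oo F" "fps_deriv F" Z] by metis
qed

lemma is_point_count_poly_trace_poly:
  "is_point_count_poly (\<lambda>k. 1 + [:[:0, 1:]:] ^ k - trace_poly k)"
  unfolding is_point_count_poly_def
proof (intro conjI allI)
  fix q x :: rat
  define D where "D = 1 - fps_const (1 + q - x) * fps_X + fps_const q * fps_X ^ 2"
  define E where "E = 1 - fps_const (1 + q) * fps_X + fps_const q * fps_X ^ 2"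
  define S where "S = Abs_fps (\<lambda>k. eval2 (trace_poly (Suc k)) q x)"
  define H where "H = Abs_fps (\<lambda>k. 1 + q ^ Suc k)"
  define F where "F = Abs_fps (\<lambda>k. eval2 (1 + [:[:0, 1:]:] ^ k - trace_poly k) q x / of_nat k)"
  have SD: "S * D = - fps_deriv D"
    unfolding S_def D_def by (rule fps_log_deriv_quadratic) (simp_all add: eval2_hom)
  have HE: "H * E = - fps_deriv E"
    unfolding H_def E_def by (rule fps_log_deriv_quadratic) (simp_all add: algebra_simps)
  have F': "fps_deriv F = H - S"
    by (simp add: F_def H_def S_def fps_eq_iff eval2_hom del: of_nat_Suc)
  have E: "(1 - fps_X) * (1 - fps_const q * fps_X) = E"
    by (simp add: E_def algebra_simps power2_eq_square flip: fps_const_add)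
  have E0: "E $ 0 = 1" "D $ 0 = 1"
    by (simp_all add: E_def D_def)
  define Z where "Z = D / E"
  have ZE: "Z * E = D"
    unfolding Z_def using E0 by (simp add: fps_divide_unit inverse_mult_eq_1 mult.assoc)
  have "fps_deriv Z * E = (fps_deriv F * Z) * E"
  proof -
    have "fps_deriv Z * E + Z * fps_deriv E = fps_deriv D"
      using arg_cong[OF ZE, of fps_deriv] by (simp add: add.commute)
    hence "fps_deriv Z * E = Z * (H * E) - S * D"
      unfolding SD HE by (simp add: algebra_simps)
    thus ?thesis
      unfolding F' ZE[symmetric] by (simp add: algebra_simps)
  qed
  moreover have "E \<noteq> 0"
    using E0 by auto
  ultimately have "fps_deriv Z = fps_deriv F * Z"
    by simp
  moreover have "Z $ 0 = 1"
    using arg_cong[OF ZE, of "\<lambda>f. f $ 0"] E0 by simp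
  moreover have "F $ 0 = 0"
    by (simp add: F_def)
  ultimately have "fps_exp 1 oo F = Z"
    by (simp add: fps_exp_compose_eq_iff)
  thus "fps_exp 1 oo Abs_fps (\<lambda>k. eval2 (1 + [:[:0, 1:]:] ^ k - trace_poly k) q x / of_nat k) =
        curve_zeta q x"
    by (simp add: F_def Z_def curve_zeta_def D_def E)
qed simp

lemma is_point_count_poly_unique:
  assumes "is_point_count_poly M" "is_point_count_poly N"
  shows "M = N"
proof
  fix k
  show "M k = N k"
  proof (cases k)
    case 0
    thus ?thesis using assms by (simp add: is_point_count_poly_def)
  next
    case (Suc m)
    show ?thesis
    proof (rule eval2_rat_eqI)
      fix q x :: rat
      define F where "F = (\<lambda>N. Abs_fps (\<lambda>k. eval2 (N k) q x / of_nat k))"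
      have F0: "F N $ 0 = 0" for N
        by (simp add: F_def)
      have *: "fps_exp 1 oo F M = curve_zeta q x" "fps_exp 1 oo F N = curve_zeta q x"
        using assms by (simp_all add: F_def is_point_count_poly_def)
      have "curve_zeta q x $ 0 = 1"
        and eq: "fps_deriv (F M) * curve_zeta q x = fps_deriv (F N) * curve_zeta q x"
        using * by (simp_all add: fps_exp_compose_eq_iff[OF F0])
      hence "curve_zeta q x \<noteq> 0"
        by auto
      hence "fps_deriv (F M) $ m = fps_deriv (F N) $ m"
        using eq by simp
      thus "eval2 (M k) q x = eval2 (N k) q x"
        by (simp add: F_def Suc del: of_nat_Suc)
    qed
  qed
qed

lemma N_poly_eq: "N_poly = (\<lambda>k. 1 + [:[:0, 1:]:] ^ k - trace_poly k)"
  unfolding N_poly_def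
  by (rule the_equality) (auto intro: is_point_count_poly_trace_poly is_point_count_poly_unique)

theorem is_point_count_poly_N_poly: "is_point_count_poly N_poly"
  unfolding N_poly_eq by (rule is_point_count_poly_trace_poly)

theorem eval2_N_poly:
  assumes "\<alpha> + \<beta> = 1 + q - x" "\<alpha> * \<beta> = q"
  shows "eval2 (N_poly k) q x = 1 + q ^ k - \<alpha> ^ k - \<beta> ^ k"
  unfolding N_poly_eq by (simp add: eval2_hom eval2_trace_poly[OF assms])

end

theory Submission
  imports Defs
begin

text \<open>
  The wheel is Eulerian and its hub is joined to every rim vertex, so a stable configuration is
  critical iff every rim vertex can fire once after the bank has fired. This fails exactly if some
  nonempty set \<open>S\<close> of rim vertices is forbidden: each \<open>v \<in> S\<close> has fewer dollars than there are arcs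
  from \<open>S\<close> to \<open>v\<close>. Read as a cyclic word over \<open>{0..q + t}\<close>, a configuration has no forbidden set iff
  it contains a letter exceeding \<open>q\<close> and labels a closed walk in a deterministic two-state automaton
  with transfer matrix \<open>((t + q, 1), (t, 1))\<close>. This matrix has trace \<open>1 + q + t\<close> and determinant \<open>q\<close>,
  so there are \<open>\<alpha>\<^sup>k + \<beta>\<^sup>k\<close> closed walks of length \<open>k\<close>. Of these, \<open>q\<^sup>k + 1\<close> use no letter exceeding
  \<open>q\<close>; a word with such a letter labels at most one closed walk, since the letter resets the state.
\<close>

section \<open>The burning criterion\<close>

context fin_digraph
begin

lemma num_arcs_outside: "v \<notin> verts G \<Longrightarrow> num_arcs G u v = 0"
  using head_in_verts by (fastforce simp: num_arcs_def card_eq_0_iff)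

text \<open>
  Here \<open>f u\<close> is the number of times \<open>u\<close> has fired and \<open>r u\<close> the time of its last firing. A vertex
  keeps everything it has received since its own last firing.
\<close>

lemma firing_history:
  assumes "(fire_step G b)\<^sup>*\<^sup>* c d"
  shows "\<exists>(f :: 'a \<Rightarrow> nat) (r :: 'a \<Rightarrow> nat) n.
    (\<forall>v \<in> verts G. d v = c v + (\<Sum>u\<in>verts G. int (f u) * int (num_arcs G u v)) - int (f v) * int (out_degree G v)) \<and>
    (\<forall>u. r u \<le> n) \<and> (\<forall>u. f u > 0 \<longrightarrow> r u > 0) \<and>
    (\<forall>v \<in> verts G - {b}. r v > 0 \<longrightarrow>
       (\<Sum>u | u \<in> verts G - {b} \<and> r v \<le> r u. int (num_arcs G u v)) \<le> d v)"
  using assms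
proof (induction rule: rtranclp_induct)
  case base
  show ?case
    by (rule exI[of _ "\<lambda>_. 0"], rule exI[of _ "\<lambda>_. 0"], rule exI[of _ 0]) simp
next
  case (step d e)
  obtain f r :: "'a \<Rightarrow> nat" and n where
    "\<forall>v\<in>verts G. d v = c v + (\<Sum>u\<in>verts G. int (f u) * int (num_arcs G u v)) - int (f v) * int (out_degree G v)"
    "\<forall>u. r u \<le> n" "\<forall>u. f u > 0 \<longrightarrow> r u > 0"
    "\<forall>v\<in>verts G - {b}. r v > 0 \<longrightarrow>
       (\<Sum>u | u \<in> verts G - {b} \<and> r v \<le> r u. int (num_arcs G u v)) \<le> d v"
    using step.IH by (elim exE conjE) (rule that)
  note f = this(1)[rule_format] and r = this(2,3)[rule_format] and d = this(4)[rule_format]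
  obtain w where w: "can_fire G b d w" and e: "e = fire G w d"
    using step.hyps(2) by (auto simp: fire_step_def)
  have wV: "w \<in> verts G"
    using w by (simp add: can_fire_def)
  \<comment> \<open>Since \<open>n\<close> bounds all earlier times, the time \<open>Suc n\<close>
    makes \<open>w\<close> strictly the last to have fired.\<close>
  let ?f = "f(w := Suc (f w))" and ?r = "r(w := Suc n)"
  have "e v = c v + (\<Sum>u\<in>verts G. int (?f u) * int (num_arcs G u v)) - int (?f v) * int (out_degree G v)"
    if v: "v \<in> verts G" for v
  proof -
    have "(\<Sum>u\<in>verts G. int (?f u) * int (num_arcs G u v)) =
          (\<Sum>u\<in>verts G. int (f u) * int (num_arcs G u v) + (if u = w then int (num_arcs G u v) else 0))"
      by (rule sum.cong) (auto simp: algebra_simps)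
    also have "\<dots> = (\<Sum>u\<in>verts G. int (f u) * int (num_arcs G u v)) + int (num_arcs G w v)"
      using wV by (simp add: sum.distrib)
    finally show ?thesis
      using f[OF v] by (auto simp: e fire_def algebra_simps)
  qed
  moreover have "\<forall>u. ?r u \<le> Suc n"
    using r(1) by (auto intro: le_SucI)
  moreover have "\<forall>u. ?f u > 0 \<longrightarrow> ?r u > 0"
    using r(2) by auto
  moreover have "(\<Sum>u | u \<in> verts G - {b} \<and> ?r v \<le> ?r u. int (num_arcs G u v)) \<le> e v"
    if v: "v \<in> verts G - {b}" "?r v > 0" for v
  proof (cases "v = w")
    case True
    \<comment> \<open>Only loops at \<open>w\<close> contribute here, and their dollars come
      straight back.\<close>
    have "{u \<in> verts G - {b}. ?r v \<le> ?r u} = {w}"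
      using True v wV r(1) by (auto simp: not_less_eq_eq[symmetric])
    moreover have "int (out_degree G w) \<le> d w"
      using w v True by (simp add: can_fire_def)
    ultimately show ?thesis
      using True by (simp add: e fire_def)
  next
    case False
    let ?A = "{u \<in> verts G - {b}. r v \<le> r u}"
    have fin: "finite ?A"
      by simp
    have "(\<Sum>u | u \<in> verts G - {b} \<and> ?r v \<le> ?r u. int (num_arcs G u v)) \<le>
          (\<Sum>u\<in>insert w ?A. int (num_arcs G u v))"
      by (rule sum_mono2) (use False in auto)
    also have "\<dots> \<le> int (num_arcs G w v) + (\<Sum>u\<in>?A. int (num_arcs G u v))"
      using fin by (simp add: sum.insert_if)
    also have "\<dots> \<le> int (num_arcs G w v) + d v"
      using d[of v] v False by simp
    also have "\<dots> = e v"
      using False by (simp add: e fire_def)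
    finally show ?thesis .
  qed
  ultimately show ?case
    by blast
qed

text \<open>
  If every vertex fires, the member of \<open>S\<close> whose last firing is earliest afterwards receives a dollar
  along every arc from \<open>S\<close>.
\<close>

lemma recurrent_imp_no_forbidden:
  assumes "stable G b c" "recurrent G b c"
    and b: "\<And>v. v \<in> verts G - {b} \<Longrightarrow> num_arcs G b v > 0"
    and S: "S \<subseteq> verts G - {b}" "S \<noteq> {}"
  shows "\<exists>v\<in>S. (\<Sum>u\<in>S. int (num_arcs G u v)) \<le> c v"
proof -
  obtain d where d: "fire_step G b c d" "(fire_step G b)\<^sup>*\<^sup>* d c"
    using assms(2) by (auto simp: recurrent_def dest: tranclpD)
  then obtain w where w: "can_fire G b c w" "d = fire G w c"
    by (auto simp: fire_step_def)
  have "w = b"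
    using w(1) assms(1) by (force simp: can_fire_def stable_def split: if_splits)
  obtain f r :: "'a \<Rightarrow> nat" where
    "\<forall>v\<in>verts G. c v = d v + (\<Sum>u\<in>verts G. int (f u) * int (num_arcs G u v)) - int (f v) * int (out_degree G v)"
    "\<forall>u. f u > 0 \<longrightarrow> r u > 0"
    "\<forall>v\<in>verts G - {b}. r v > 0 \<longrightarrow>
       (\<Sum>u | u \<in> verts G - {b} \<and> r v \<le> r u. int (num_arcs G u v)) \<le> c v"
    using firing_history[OF d(2)] by (elim exE conjE) (rule that)
  note f = this(1)[rule_format] and r = this(2)[rule_format] and c = this(3)[rule_format]
  \<comment> \<open>The bank's firing raised \<open>v\<close> above \<open>c v\<close>, and only a
    firing of \<open>v\<close> itself can lower it again.\<close>
  have pos: "r v > 0" if v: "v \<in> verts G - {b}" for v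
  proof (rule r, rule ccontr)
    assume "\<not> f v > 0"
    hence "c v = d v + (\<Sum>u\<in>verts G. int (f u) * int (num_arcs G u v))"
      using f[of v] v by simp
    moreover have "d v = c v + int (num_arcs G b v)"
      using v w \<open>w = b\<close> by (simp add: fire_def)
    moreover have "(\<Sum>u\<in>verts G. int (f u) * int (num_arcs G u v)) \<ge> 0"
      by (intro sum_nonneg) auto
    ultimately show False
      using b[OF v] by linarith
  qed
  have "finite S"
    using S(1) finite_verts finite_subset by blast
  then obtain v where v: "v \<in> S" "\<And>u. u \<in> S \<Longrightarrow> r v \<le> r u"
    using S(2) by (metis arg_min_if_finite(1) arg_min_least)
  have "(\<Sum>u\<in>S. int (num_arcs G u v)) \<le>
        (\<Sum>u | u \<in> verts G - {b} \<and> r v \<le> r u. int (num_arcs G u v))"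
    by (rule sum_mono2) (use S v in auto)
  also have "\<dots> \<le> c v"
    using c pos v S by blast
  finally show ?thesis
    using v by blast
qed

text \<open>Once the bank has fired, let every other vertex fire once. As long as some have not,
  they form a set that is not forbidden, and one of its members can fire. When all have fired, the
  Eulerian condition restores \<open>c\<close>.\<close>

lemma no_forbidden_imp_recurrent:
  assumes b: "b \<in> verts G" and st: "stable G b c"
    and eulerian: "\<And>v. v \<in> verts G \<Longrightarrow> (\<Sum>u\<in>verts G. num_arcs G u v) = out_degree G v"
    and nf: "\<And>S. S \<subseteq> verts G - {b} \<Longrightarrow> S \<noteq> {} \<Longrightarrow> \<exists>v\<in>S. (\<Sum>u\<in>S. int (num_arcs G u v)) \<le> c v"
  shows "recurrent G b c"
proof -
  \<comment> \<open>This is the configuration reached from \<open>c\<close> when every vertex of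
    \<open>F\<close> has fired exactly once.\<close>
  define after where "after F = (\<lambda>v. c v + (\<Sum>u\<in>F. int (num_arcs G u v)) -
    (if v \<in> F then int (out_degree G v) else 0))" for F
  have fire_after: "fire G w (after F) = after (insert w F)" if "w \<notin> F" "finite F" for w F
    using that by (auto simp: fire_def after_def fun_eq_iff)
  have first: "fire_step G b c (after {b})"
  proof -
    have "after {} = c"
      by (simp add: after_def)
    hence "after {b} = fire G b c"
      using fire_after[of b "{}"] by simp
    thus ?thesis
      using st b by (auto simp: fire_step_def can_fire_def)
  qed
  have "(fire_step G b)\<^sup>*\<^sup>* (after F) (after (verts G))" if "b \<in> F" "F \<subseteq> verts G" for F
    using that
  proof (induction "card (verts G - F)" arbitrary: F rule: less_induct)
    case less
    show ?case
    proof (cases "F = verts G")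
      case False
      define S where "S = verts G - F"
      have "S \<subseteq> verts G - {b}" "S \<noteq> {}"
        using less.prems False by (auto simp: S_def)
      then obtain v where v: "v \<in> S" "(\<Sum>u\<in>S. int (num_arcs G u v)) \<le> c v"
        using nf by blast
      have finF: "finite F"
        using less.prems finite_verts finite_subset by blast
      have vV: "v \<in> verts G" "v \<notin> F" "v \<noteq> b"
        using v(1) less.prems by (auto simp: S_def)
      \<comment> \<open>The dollars needed to fire \<open>v\<close> come in two portions: those for
        arcs from \<open>S\<close> by the choice of \<open>v\<close>, those for arcs from
        \<open>F\<close> by the firings already made.\<close>
      have "int (out_degree G v) = (\<Sum>u\<in>verts G. int (num_arcs G u v))"
        using eulerian[OF vV(1)] by (metis of_nat_sum)
      also have "\<dots> = (\<Sum>u\<in>S. int (num_arcs G u v)) + (\<Sum>u\<in>F. int (num_arcs G u v))"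
        unfolding S_def using less.prems by (intro sum.subset_diff) auto
      also have "\<dots> \<le> after F v"
        using v vV by (simp add: after_def)
      finally have "can_fire G b (after F) v"
        using vV by (simp add: can_fire_def)
      hence "fire_step G b (after F) (after (insert v F))"
        using fire_after[OF vV(2) finF] by (auto simp: fire_step_def)
      moreover have "(fire_step G b)\<^sup>*\<^sup>* (after (insert v F)) (after (verts G))"
      proof (rule less.hyps)
        show "card (verts G - insert v F) < card (verts G - F)"
          using vV by (intro psubset_card_mono) auto
      qed (use less.prems vV in auto)
      ultimately show ?thesis
        by (rule converse_rtranclp_into_rtranclp)
    qed simp
  qed
  hence "(fire_step G b)\<^sup>*\<^sup>* (after {b}) (after (verts G))"
    using b by simp
  moreover have "after (verts G) = c"
  proof
    fix v
    show "after (verts G) v = c v"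
      using eulerian[of v] num_arcs_outside[of v]
      by (cases "v \<in> verts G") (simp_all add: after_def flip: of_nat_sum)
  qed
  ultimately show ?thesis
    unfolding recurrent_def using first by (metis rtranclp_into_tranclp2)
qed

end


section \<open>Arcs of the wheel\<close>

lemma verts_wheel: "verts (wheel k q t) = {0..k}"
  by (simp add: wheel_def)

section \<open>Neighbours on the rim\<close>

lemma rim_next_in_rim: "i \<in> {1..k} \<Longrightarrow> rim_next k i \<in> {1..k}"
  by (auto simp: rim_next_def)

lemma rim_prev_in_rim: "i \<in> {1..k} \<Longrightarrow> rim_prev k i \<in> {1..k}"
  by (auto simp: rim_prev_def)

lemma rim_prev_eq_iff: "i \<in> {1..k} \<Longrightarrow> j \<in> {1..k} \<Longrightarrow> rim_prev k i = j \<longleftrightarrow> i = rim_next k j"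
  by (auto simp: rim_prev_def rim_next_def)

lemma rim_next_eq_iff: "i \<in> {1..k} \<Longrightarrow> j \<in> {1..k} \<Longrightarrow> rim_next k i = j \<longleftrightarrow> i = rim_prev k j"
  by (auto simp: rim_prev_def rim_next_def)

lemma rim_next_prev [simp]: "i \<in> {1..k} \<Longrightarrow> rim_next k (rim_prev k i) = i"
  by (auto simp: rim_prev_def rim_next_def)

lemma rim_prev_next [simp]: "i \<in> {1..k} \<Longrightarrow> rim_prev k (rim_next k i) = i"
  by (auto simp: rim_prev_def rim_next_def)

text \<open>Repeated \<open>rim_next\<close> reaches the whole rim: climb from \<open>v\<close> to
  \<open>k\<close>, wrap around to 1, and climb again.\<close>

lemma rim_next_closed:
  assumes "v \<in> {1..k}" "P v" "\<And>u. u \<in> {1..k} \<Longrightarrow> P u \<Longrightarrow> P (rim_next k u)" "w \<in> {1..k}"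
  shows "P w"
proof -
  have up: "P j" if "i \<le> j" "P i" "1 \<le> i" "j \<le> k" for i j
    using that
  proof (induction j rule: dec_induct)
    case (step j)
    thus ?case
      using assms(3)[of j] by (simp add: rim_next_def)
  qed
  have "P k"
    using up[of v k] assms by auto
  hence "P 1"
    using assms(1) assms(3)[of k] by (simp add: rim_next_def)
  thus ?thesis
    using up[of 1 w] assms by auto
qed

section \<open>Arc counts and degrees\<close>

lemma fin_digraph_wheel: "fin_digraph (wheel k q t)"
proof
  have "arcs (wheel k q t) \<subseteq> (\<lambda>(i, j). From_Hub i j) ` ({1..k} \<times> {..<t})
      \<union> (\<lambda>(i, j). To_Hub i j) ` ({1..k} \<times> {..<t}) \<union> Backward ` {1..k}
      \<union> (\<lambda>(i, j). Forward i j) ` ({1..k} \<times> {..<q})"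
    by (auto simp: wheel_def)
  thus "finite (arcs (wheel k q t))"
    by (rule finite_subset) auto
qed (auto simp: wheel_def rim_next_def rim_prev_def)

lemma num_arcs_wheel_hub_rim: "v \<in> {1..k} \<Longrightarrow> num_arcs (wheel k q t) 0 v = t"
proof -
  assume "v \<in> {1..k}"
  hence "{e \<in> arcs (wheel k q t). tail (wheel k q t) e = 0 \<and> head (wheel k q t) e = v} = From_Hub v ` {..<t}"
    by (auto simp: wheel_def)
  thus ?thesis
    by (simp add: num_arcs_def card_image inj_on_def)
qed

lemma num_arcs_wheel_rim_hub: "v \<in> {1..k} \<Longrightarrow> num_arcs (wheel k q t) v 0 = t"
proof -
  assume v: "v \<in> {1..k}"
  have "{e \<in> arcs (wheel k q t). tail (wheel k q t) e = v \<and> head (wheel k q t) e = 0} = To_Hub v ` {..<t}"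
    using v rim_next_in_rim[OF v] rim_prev_in_rim[OF v] by (auto simp: wheel_def)
  thus ?thesis
    by (simp add: num_arcs_def card_image inj_on_def)
qed

lemma num_arcs_wheel_hub_hub: "num_arcs (wheel k q t) 0 0 = 0"
proof -
  have "{e \<in> arcs (wheel k q t). tail (wheel k q t) e = 0 \<and> head (wheel k q t) e = 0} = {}"
    by (auto simp: wheel_def)
  thus ?thesis
    unfolding num_arcs_def by (simp only: card.empty)
qed

text \<open>The two summands add rather than exclude each other, since both neighbours of
  \<open>v\<close> coincide when \<open>k\<close> is 1 or 2; for \<open>k = 1\<close> they are
  \<open>v\<close> itself and the arcs are loops.\<close>

lemma num_arcs_wheel_rim_rim:
  assumes "u \<in> {1..k}" "v \<in> {1..k}"
  shows "num_arcs (wheel k q t) u v = (if u = rim_next k v then 1 else 0) + (if u = rim_prev k v then q else 0)"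
proof -
  let ?A = "if u = rim_next k v then {Backward u} else {}"
  let ?B = "if u = rim_prev k v then Forward u ` {..<q} else {}"
  have eq: "{e \<in> arcs (wheel k q t). tail (wheel k q t) e = u \<and> head (wheel k q t) e = v} = ?A \<union> ?B"
    using assms rim_next_eq_iff[OF assms] rim_prev_eq_iff[OF assms] by (auto simp: wheel_def)
  have "card (?A \<union> ?B) = card ?A + card ?B"
    by (rule card_Un_disjoint) auto
  thus ?thesis
    unfolding num_arcs_def eq by (simp add: card_image inj_on_def)
qed

lemma out_degree_wheel_rim:
  assumes "v \<in> {1..k}"
  shows "out_degree (wheel k q t) v = 1 + q + t"
proof -
  have eq: "out_arcs (wheel k q t) v = insert (Backward v) (To_Hub v ` {..<t} \<union> Forward v ` {..<q})"
    using assms by (auto simp: out_arcs_def wheel_def)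
  have "card (To_Hub v ` {..<t} \<union> Forward v ` {..<q}) = t + q"
    by (subst card_Un_disjoint) (auto simp: card_image inj_on_def)
  thus ?thesis
    unfolding out_degree_def eq by (subst card_insert_disjoint) auto
qed

lemma out_degree_wheel_hub: "out_degree (wheel k q t) 0 = k * t"
proof -
  have eq: "out_arcs (wheel k q t) 0 = (\<lambda>(i, j). From_Hub i j) ` ({1..k} \<times> {..<t})"
    by (auto simp: out_arcs_def wheel_def)
  have "inj_on (\<lambda>(i, j). From_Hub i j) ({1..k} \<times> {..<t})"
    by (auto simp: inj_on_def)
  thus ?thesis
    unfolding out_degree_def eq by (simp add: card_image)
qed

lemma sum_num_arcs_wheel_rim:
  assumes "S \<subseteq> {1..k}" "v \<in> {1..k}"
  shows "(\<Sum>u\<in>S. num_arcs (wheel k q t) u v) =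
         (if rim_next k v \<in> S then 1 else 0) + (if rim_prev k v \<in> S then q else 0)"
proof -
  have "finite S"
    using assms(1) finite_subset by blast
  have "(\<Sum>u\<in>S. num_arcs (wheel k q t) u v) =
        (\<Sum>u\<in>S. (if u = rim_next k v then 1 else 0) + (if u = rim_prev k v then q else 0))"
    by (rule sum.cong) (use assms num_arcs_wheel_rim_rim in blast)+
  thus ?thesis
    using \<open>finite S\<close> by (simp add: sum.distrib)
qed

lemma wheel_eulerian:
  assumes "v \<in> verts (wheel k q t)"
  shows "(\<Sum>u\<in>verts (wheel k q t). num_arcs (wheel k q t) u v) = out_degree (wheel k q t) v"
proof -
  have "(\<Sum>u\<in>verts (wheel k q t). num_arcs (wheel k q t) u v) =
        num_arcs (wheel k q t) 0 v + (\<Sum>u\<in>{1..k}. num_arcs (wheel k q t) u v)"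
    by (simp add: verts_wheel sum.atLeast_Suc_atMost)
  also have "\<dots> = out_degree (wheel k q t) v"
  proof (cases "v = 0")
    case True
    thus ?thesis
      by (simp add: num_arcs_wheel_hub_hub num_arcs_wheel_rim_hub out_degree_wheel_hub)
  next
    case False
    hence v: "v \<in> {1..k}"
      using assms by (simp add: verts_wheel)
    show ?thesis
      using v rim_next_in_rim[OF v] rim_prev_in_rim[OF v]
      by (simp only: sum_num_arcs_wheel_rim[OF order.refl v] num_arcs_wheel_hub_rim[OF v]
          out_degree_wheel_rim[OF v]) simp
  qed
  finally show ?thesis .
qed

text \<open>Recurrence excludes forbidden sets because \<open>t \<ge> 1\<close> lets the bank's
  firing reach each rim vertex; the converse holds because the wheel is Eulerian. Arcs into
  \<open>v\<close> from \<open>S\<close> come from its two rim neighbours.\<close>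

lemma critical_wheel_iff:
  assumes "t \<ge> 1"
  shows "critical (wheel k q t) 0 c \<longleftrightarrow> config (wheel k q t) 0 c \<and> stable (wheel k q t) 0 c \<and>
    (\<forall>S. S \<subseteq> {1..k} \<longrightarrow> S \<noteq> {} \<longrightarrow>
      (\<exists>v\<in>S. int ((if rim_next k v \<in> S then 1 else 0) + (if rim_prev k v \<in> S then q else 0)) \<le> c v))"
proof -
  interpret fin_digraph "wheel k q t"
    by (rule fin_digraph_wheel)
  have V: "verts (wheel k q t) - {0} = {1..k}"
    by (auto simp: verts_wheel)
  have S: "(\<Sum>u\<in>S. int (num_arcs (wheel k q t) u v)) =
      int ((if rim_next k v \<in> S then 1 else 0) + (if rim_prev k v \<in> S then q else 0))"
    if "S \<subseteq> {1..k}" "v \<in> S" for S v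
    using sum_num_arcs_wheel_rim[OF that(1), of v q t] that by (auto simp flip: of_nat_sum)
  have "0 \<in> verts (wheel k q t)"
    by (simp add: verts_wheel)
  moreover have "num_arcs (wheel k q t) 0 v > 0" if "v \<in> {1..k}" for v
    using num_arcs_wheel_hub_rim[OF that, of q t] assms by simp
  ultimately have "recurrent (wheel k q t) 0 c \<longleftrightarrow>
      (\<forall>S. S \<subseteq> {1..k} \<longrightarrow> S \<noteq> {} \<longrightarrow> (\<exists>v\<in>S. (\<Sum>u\<in>S. int (num_arcs (wheel k q t) u v)) \<le> c v))"
    if st: "stable (wheel k q t) 0 c"
    using recurrent_imp_no_forbidden[OF st, unfolded V] no_forbidden_imp_recurrent[OF _ st, unfolded V]
      wheel_eulerian by meson
  moreover have "(\<exists>v\<in>S. (\<Sum>u\<in>S. int (num_arcs (wheel k q t) u v)) \<le> c v) \<longleftrightarrow>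
      (\<exists>v\<in>S. int ((if rim_next k v \<in> S then 1 else 0) + (if rim_prev k v \<in> S then q else 0)) \<le> c v)"
    if "S \<subseteq> {1..k}" for S
    by (rule bex_cong[OF refl]) (simp only: S[OF that])
  ultimately show ?thesis
    unfolding critical_def by blast
qed


section \<open>The automaton\<close>

text \<open>
  The state records whether a letter \<open>0\<close> has been read since the last letter exceeding \<open>q\<close>. If so,
  only \<open>q\<close> or a letter exceeding \<open>q\<close> may follow, since otherwise the stretch from that \<open>0\<close> onwards
  would be a forbidden set.
\<close>

definition step :: "nat \<Rightarrow> bool \<Rightarrow> nat \<Rightarrow> bool \<Rightarrow> bool" where
  "step q s x s' \<longleftrightarrow> (if x > q then \<not> s' else if s then x = q \<and> s' else s' = (x = 0))"

text \<open>A cycle offers no first letter at which a recursion for the state could start, so the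
  state is taken as a least fixed point.\<close>

inductive zero_seen :: "nat \<Rightarrow> nat \<Rightarrow> (nat \<Rightarrow> nat) \<Rightarrow> nat \<Rightarrow> bool" for k q x where
  zero: "v \<in> {1..k} \<Longrightarrow> x v = 0 \<Longrightarrow> zero_seen k q x v"
| continue: "v \<in> {1..k} \<Longrightarrow> zero_seen k q x (rim_prev k v) \<Longrightarrow> x v \<le> q \<Longrightarrow> zero_seen k q x v"

text \<open>\<open>S\<close> is built as the stretch from a 0 up to \<open>v\<close>. It is
  forbidden except possibly at \<open>v\<close>, which is credited with an arc from a successor not
  yet in \<open>S\<close>; hence the disjunct \<open>u = v\<close>. Extending by a letter at most
  \<open>q\<close> pays the credit of the old end and grants one to the new end.\<close>

lemma zero_seen_almost_forbidden:
  assumes "zero_seen k q x v"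
  shows "\<exists>S \<subseteq> {1..k}. v \<in> S \<and>
    (\<forall>u\<in>S. x u < (if u = v \<or> rim_next k u \<in> S then 1 else 0) + (if rim_prev k u \<in> S then q else 0))"
  using assms
proof induction
  case (zero v)
  thus ?case
    by (intro exI[of _ "{v}"]) auto
next
  case (continue v)
  then obtain S where S: "S \<subseteq> {1..k}" "rim_prev k v \<in> S"
    "\<And>u. u \<in> S \<Longrightarrow> x u < (if u = rim_prev k v \<or> rim_next k u \<in> S then 1 else 0) + (if rim_prev k u \<in> S then q else 0)"
    by blast
  have "x u < (if u = v \<or> rim_next k u \<in> insert v S then 1 else 0) + (if rim_prev k u \<in> insert v S then q else 0)"
    if "u \<in> insert v S" for u
    using S(2) S(3)[of u] that continue(1,3) by (cases "u = v") (auto split: if_splits)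
  moreover have "insert v S \<subseteq> {1..k}"
    using S(1) continue(1) by blast
  ultimately show ?case
    by blast
qed

text \<open>In one direction \<open>zero_seen\<close> supplies the states. Conversely, a forbidden
  set misses each vertex whose letter exceeds \<open>q\<close>, so it has a first vertex; the run
  then forces it to continue around the rim up to such a vertex.\<close>

lemma no_forbidden_iff_closed_run:
  assumes k: "k \<ge> 1"
  shows "(\<forall>S. S \<subseteq> {1..k} \<longrightarrow> S \<noteq> {} \<longrightarrow>
      (\<exists>v\<in>S. (if rim_next k v \<in> S then 1 else 0) + (if rim_prev k v \<in> S then q else 0) \<le> x v)) \<longleftrightarrow>
    (\<exists>v\<in>{1..k}. x v > q) \<and> (\<exists>s. \<forall>v\<in>{1..k}. step q (s (rim_prev k v)) (x v) (s v))"
    (is "?L \<longleftrightarrow> ?R")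
proof
  assume L: ?L
  have "\<exists>v\<in>{1..k}. x v > q"
  proof -
    \<comment> \<open>For the whole rim both neighbours lie in the set, so the bound is
      \<open>1 + q\<close>.\<close>
    obtain v where v: "v \<in> {1..k}"
      "(if rim_next k v \<in> {1..k} then 1 else 0) + (if rim_prev k v \<in> {1..k} then q else 0) \<le> x v"
      using L[rule_format, of "{1..k}"] k by (metis atLeastatMost_empty_iff2 not_le order_refl)
    have "x v > q"
      using v(2) rim_next_in_rim[OF v(1)] rim_prev_in_rim[OF v(1)] by simp
    thus ?thesis
      using v(1) by blast
  qed
  moreover have "step q (zero_seen k q x (rim_prev k v)) (x v) (zero_seen k q x v)" if v: "v \<in> {1..k}" for v
  proof -
    \<comment> \<open>With a letter below \<open>q\<close> at \<open>v\<close>, adding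
      \<open>v\<close> to the almost forbidden set pays its credit and yields a forbidden
      set.\<close>
    have "x v \<ge> q" if zs: "zero_seen k q x (rim_prev k v)"
    proof (rule ccontr)
      assume "\<not> x v \<ge> q"
      obtain S where S: "S \<subseteq> {1..k}" "rim_prev k v \<in> S"
        "\<And>u. u \<in> S \<Longrightarrow> x u < (if u = rim_prev k v \<or> rim_next k u \<in> S then 1 else 0) + (if rim_prev k u \<in> S then q else 0)"
        using zero_seen_almost_forbidden[OF zs] by blast
      obtain u where "u \<in> insert v S"
        "(if rim_next k u \<in> insert v S then 1 else 0) + (if rim_prev k u \<in> insert v S then q else 0) \<le> x u"
        using L[rule_format, of "insert v S"] S(1) v by blast
      thus False
        using S(2) S(3)[of u] \<open>\<not> x v \<ge> q\<close> v by (cases "u = v") (auto split: if_splits)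
    qed
    moreover have "zero_seen k q x v \<longleftrightarrow> x v = 0 \<or> (zero_seen k q x (rim_prev k v) \<and> x v \<le> q)"
      using zero_seen.simps[of k q x v] v by blast
    ultimately show ?thesis
      by (auto simp: step_def)
  qed
  ultimately show ?R
    by blast
next
  assume ?R
  then obtain b s where b: "b \<in> {1..k}" "x b > q"
    and s: "\<And>v. v \<in> {1..k} \<Longrightarrow> step q (s (rim_prev k v)) (x v) (s v)"
    by blast
  show ?L
  proof (intro allI impI, rule ccontr)
    fix S
    assume S: "S \<subseteq> {1..k}" "S \<noteq> {}"
      and "\<not> (\<exists>v\<in>S. (if rim_next k v \<in> S then 1 else 0) + (if rim_prev k v \<in> S then q else 0) \<le> x v)"
    hence F: "x v < (if rim_next k v \<in> S then 1 else 0) + (if rim_prev k v \<in> S then q else 0)" if "v \<in> S" for v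
      using that not_le by blast
    have le: "x v \<le> q" if "v \<in> S" for v
      using F[OF that] by (auto split: if_splits)
    have "b \<notin> S"
      using le b(2) by fastforce
    obtain v where v: "v \<in> S" "rim_prev k v \<notin> S"
    proof (rule ccontr)
      assume "\<not> thesis"
      hence closed: "\<And>v. v \<in> S \<Longrightarrow> rim_prev k v \<in> S"
        using that by blast
      have "u \<notin> S" if "u \<in> {1..k}" for u
        using rim_next_closed[of b k "\<lambda>u. u \<notin> S" u] b(1) \<open>b \<notin> S\<close> closed that by (metis rim_prev_next)
      thus False
        using S by blast
    qed
    \<comment> \<open>At a first vertex of \<open>S\<close> the bound forces the letter 0 and a
      successor in \<open>S\<close>. From there on the state \<open>True\<close> admits only the
      letter \<open>q\<close> inside \<open>S\<close>, and the arcs from the predecessor alone do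
      not exceed it, so the next successor lies in \<open>S\<close> too.\<close>
    let ?P = "\<lambda>u. u \<in> S \<and> rim_next k u \<in> S \<and> s u"
    have vk: "v \<in> {1..k}"
      using v S by blast
    have "?P v"
      using F[OF v(1)] v s[OF vk] by (auto simp: step_def split: if_splits)
    moreover have "?P (rim_next k u)" if u: "u \<in> {1..k}" "?P u" for u
    proof -
      let ?w = "rim_next k u"
      have "?w \<in> {1..k}"
        using u(1) by (rule rim_next_in_rim)
      hence "x ?w = q" "s ?w"
        using s[of ?w] u le[of ?w] by (auto simp: step_def split: if_splits)
      thus ?thesis
        using F[of ?w] u by (auto split: if_splits)
    qed
    ultimately have "?P b"
      using rim_next_closed[of v k ?P b] vk b(1) by blast
    thus False
      using \<open>b \<notin> S\<close> by blast
  qed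
qed

section \<open>Runs on words cut open at the first letter\<close>

primrec run :: "nat \<Rightarrow> bool \<Rightarrow> nat list \<Rightarrow> bool \<Rightarrow> bool" where
  "run q s [] s' \<longleftrightarrow> s = s'"
| "run q s (x # w) s' \<longleftrightarrow> (\<exists>r. step q s x r \<and> run q r w s')"

lemma run_iff_states:
  "run q s w s' \<longleftrightarrow>
    (\<exists>f. f 0 = s \<and> f (length w) = s' \<and> (\<forall>i<length w. step q (f i) (w ! i) (f (Suc i))))"
proof (induction w arbitrary: s)
  case Nil
  show ?case by auto
next
  case (Cons x w)
  show ?case
  proof
    assume "run q s (x # w) s'"
    then obtain f where f: "step q s x (f 0)" "f (length w) = s'"
      "\<And>i. i < length w \<Longrightarrow> step q (f i) (w ! i) (f (Suc i))"
      by (auto simp: Cons)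
    show "\<exists>f. f 0 = s \<and> f (length (x # w)) = s' \<and>
      (\<forall>i<length (x # w). step q (f i) ((x # w) ! i) (f (Suc i)))"
      by (rule exI[of _ "case_nat s f"]) (use f in \<open>auto simp: less_Suc_eq_0_disj\<close>)
  next
    assume "\<exists>f. f 0 = s \<and> f (length (x # w)) = s' \<and>
      (\<forall>i<length (x # w). step q (f i) ((x # w) ! i) (f (Suc i)))"
    then obtain f where f: "f 0 = s" "f (Suc (length w)) = s'"
      "\<And>i. i < Suc (length w) \<Longrightarrow> step q (f i) ((x # w) ! i) (f (Suc i))"
      by auto
    have "run q (f 1) w s'"
      unfolding Cons by (rule exI[of _ "\<lambda>i. f (Suc i)"]) (use f(2) f(3)[of "Suc _"] in auto)
    thus "run q s (x # w) s'"
      using f(1) f(3)[of 0] by auto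
  qed
qed

text \<open>The state of a rim vertex is the one after its letter \<open>w ! (v - 1)\<close>.
  Cutting the cycle before vertex 1 adds a state with index 0, which closure identifies with that of
  \<open>k\<close>, the value of \<open>rim_prev k 1\<close>.\<close>

lemma ex_closed_run_iff:
  assumes "length w = k" "k \<ge> 1"
  shows "(\<exists>s. run q s w s) \<longleftrightarrow>
    (\<exists>s. \<forall>v\<in>{1..k}. step q (s (rim_prev k v)) (w ! (v - 1)) (s v))"
proof
  assume "\<exists>s. run q s w s"
  then obtain f where f: "f 0 = f k" "\<And>i. i < k \<Longrightarrow> step q (f i) (w ! i) (f (Suc i))"
    using assms(1) by (auto simp: run_iff_states)
  have "step q (f (rim_prev k v)) (w ! (v - 1)) (f v)" if "v \<in> {1..k}" for v
    using f(2)[of "v - 1"] f(1) that by (auto simp: rim_prev_def)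
  thus "\<exists>s. \<forall>v\<in>{1..k}. step q (s (rim_prev k v)) (w ! (v - 1)) (s v)"
    by blast
next
  assume "\<exists>s. \<forall>v\<in>{1..k}. step q (s (rim_prev k v)) (w ! (v - 1)) (s v)"
  then obtain s where s: "\<And>v. v \<in> {1..k} \<Longrightarrow> step q (s (rim_prev k v)) (w ! (v - 1)) (s v)"
    by blast
  have "run q (s k) w (s k)"
    unfolding run_iff_states assms(1)
  \<comment> \<open>Index 0 is not a rim vertex, so \<open>s\<close> is redefined there to the state
    in which the first letter is read.\<close>
  proof (rule exI[of _ "s(0 := s k)"], intro conjI allI impI)
    fix i assume "i < k"
    thus "step q ((s(0 := s k)) i) (w ! i) ((s(0 := s k)) (Suc i))"
      using s[of "Suc i"] by (auto simp: rim_prev_def)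
  qed (use assms(2) in auto)
  thus "\<exists>s. run q s w s"
    by blast
qed


section \<open>Counting closed runs\<close>

definition run_words :: "nat \<Rightarrow> nat \<Rightarrow> nat \<Rightarrow> bool \<Rightarrow> bool \<Rightarrow> nat list set" where
  "run_words q t n s s' = {w. length w = n \<and> set w \<subseteq> {..q + t} \<and> run q s w s'}"

lemma finite_run_words [simp]: "finite (run_words q t n s s')"
  by (rule finite_subset[OF _ finite_lists_length_eq[of "{..q + t}" n]]) (auto simp: run_words_def)

lemma card_run_words_0: "card (run_words q t 0 s s') = (if s = s' then 1 else 0)"
proof -
  have "run_words q t 0 s s' = (if s = s' then {[]} else {})"
    by (auto simp: run_words_def)
  thus ?thesis by simp
qed

lemma card_run_words_Suc:
  "card (run_words q t (Suc n) s s') =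
     (if s then t else t + q) * card (run_words q t n False s') + card (run_words q t n True s')"
proof -
  define X where "X r = {x. x \<le> q + t \<and> step q s x r}" for r
  define C where "C r = (\<lambda>(x, w). x # w) ` (X r \<times> run_words q t n r s')" for r
  have "run_words q t (Suc n) s s' = C False \<union> C True"
  proof (intro equalityI subsetI)
    fix w assume w: "w \<in> run_words q t (Suc n) s s'"
    then obtain y u where [simp]: "w = y # u"
      by (cases w) (auto simp: run_words_def)
    obtain r where "step q s y r" "run q r u s'"
      using w by (auto simp: run_words_def)
    hence "w \<in> C r"
      using w by (auto simp: C_def X_def run_words_def)
    thus "w \<in> C False \<union> C True"
      by (cases r) auto
  qed (auto simp: C_def X_def run_words_def)
  \<comment> \<open>The automaton is deterministic: the first letter settles the next state.\<close>
  moreover have "C False \<inter> C True = {}"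
    by (auto simp: C_def X_def step_def split: if_splits)
  moreover have finX: "finite (X r)" for r
    by (rule finite_subset[of _ "{..q + t}"]) (auto simp: X_def)
  hence "finite (C r)" for r
    by (simp add: C_def)
  ultimately have "card (run_words q t (Suc n) s s') = card (C False) + card (C True)"
    by (simp add: card_Un_disjoint)
  moreover have "card (C r) = card (X r) * card (run_words q t n r s')" for r
    unfolding C_def by (subst card_image) (auto simp: inj_on_def card_cartesian_product)
  \<comment> \<open>The sizes of these sets of letters are the entries of the transfer matrix:
    \<open>t + q\<close> and 1 from the state \<open>False\<close>, \<open>t\<close> and 1 from
    \<open>True\<close>.\<close>
  moreover have "X False = (if s then {Suc q..q + t} else {1..q + t})"
    by (auto simp: X_def step_def)
  moreover have "X True = (if s then {q} else {0})"
    by (auto simp: X_def step_def)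
  ultimately show ?thesis
    by auto
qed

text \<open>The left side is the trace of the \<open>n\<close>-th power of the transfer matrix. By
  Cayley-Hamilton it obeys the linear recurrence given by the trace \<open>1 + q + t\<close> and the
  determinant \<open>q\<close>, which is that of \<open>trace_poly\<close> at
  \<open>x = - t\<close>.\<close>

lemma card_closed_run_words:
  "int (card (run_words q t n False False)) + int (card (run_words q t n True True)) =
   eval2 (trace_poly n) (int q) (- int t)"
proof (induction n rule: trace_poly.induct)
  case (3 n)
  show ?case
    unfolding trace_poly.simps eval2_hom eval2_1 3[symmetric]
    by (simp add: card_run_words_Suc algebra_simps)
qed (simp_all add: card_run_words_0 card_run_words_Suc eval2_hom)

section \<open>Words with and without letters exceeding \<open>q\<close>\<close>

lemma not_run_small_True_False: "set w \<subseteq> {..q} \<Longrightarrow> \<not> run q True w False"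
  by (induction w) (auto simp: step_def)

lemma run_small_False_iff:
  assumes "set w \<subseteq> {..q}"
  shows "run q False w False \<longleftrightarrow> set w \<subseteq> {1..q}"
  using assms
proof (induction w)
  case (Cons x w)
  have "\<not> run q True w False"
    using Cons.prems by (simp add: not_run_small_True_False)
  thus ?case
    using Cons by (cases "x = 0") (auto simp: step_def)
qed simp

lemma run_small_True_iff:
  assumes "set w \<subseteq> {..q}"
  shows "run q True w True \<longleftrightarrow> set w \<subseteq> {q}"
  using assms by (induction w) (auto simp: step_def)

lemma run_unique_target: "run q s w a \<Longrightarrow> run q s w b \<Longrightarrow> a = b"
proof (induction w arbitrary: s)
  case (Cons x w)
  thus ?case
    by (cases "x > q"; cases s) (auto simp: step_def)
qed simp

text \<open>The first letter exceeding \<open>q\<close> leads to \<open>False\<close> from either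
  state, and determinism does the rest. Hence the closed runs of such a word all have the same
  state.\<close>

lemma run_big_forgets_start:
  "run q r w a \<Longrightarrow> run q s w b \<Longrightarrow> x \<in> set w \<Longrightarrow> x > q \<Longrightarrow> a = b"
proof (induction w arbitrary: r s)
  case (Cons y w)
  show ?case
  proof (cases "y > q")
    case True
    hence "run q False w a" "run q False w b"
      using Cons.prems by (auto simp: step_def)
    thus ?thesis
      by (rule run_unique_target)
  next
    case False
    thus ?thesis
      using Cons by auto
  qed
qed simp

definition critical_words :: "nat \<Rightarrow> nat \<Rightarrow> nat \<Rightarrow> nat list set" where
  "critical_words q t n = {w. length w = n \<and> set w \<subseteq> {..q + t} \<and> (\<exists>x\<in>set w. x > q) \<and> (\<exists>s. run q s w s)}"

text \<open>The trace counts the closed runs at both states. Those using only letters up to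
  \<open>q\<close> are removed: at \<open>False\<close> they avoid 0, which gives
  \<open>q ^ n\<close> words; at \<open>True\<close> every letter is \<open>q\<close>, which gives
  one.\<close>

lemma card_critical_words:
  "int (card (critical_words q t n)) = eval2 (trace_poly n) (int q) (- int t) - int q ^ n - 1"
proof -
  define B where "B s = {w \<in> run_words q t n s s. \<exists>x\<in>set w. x > q}" for s
  define L where "L s = {w \<in> run_words q t n s s. set w \<subseteq> {..q}}" for s
  have fin: "finite (B s)" "finite (L s)" for s
    by (simp_all add: B_def L_def)
  have split: "card (run_words q t n s s) = card (B s) + card (L s)" for s
  proof -
    have "run_words q t n s s = B s \<union> L s" "B s \<inter> L s = {}"
      by (auto simp: B_def L_def subset_iff not_le)
    thus ?thesis
      using fin by (simp add: card_Un_disjoint)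
  qed
  have "w \<in> L False \<longleftrightarrow> set w \<subseteq> {1..q} \<and> length w = n" for w
  proof -
    have "set w \<subseteq> {..q}" "set w \<subseteq> {..q + t}" if "set w \<subseteq> {1..q}"
      using that by fastforce+
    thus ?thesis
      unfolding L_def run_words_def using run_small_False_iff[of w q] by blast
  qed
  hence "L False = {w. set w \<subseteq> {1..q} \<and> length w = n}"
    by blast
  hence LF: "card (L False) = q ^ n"
    using card_lists_length_eq[of "{1..q}" n] by simp
  have "w \<in> L True \<longleftrightarrow> set w \<subseteq> {q} \<and> length w = n" for w
  proof -
    have "set w \<subseteq> {..q}" "set w \<subseteq> {..q + t}" if "set w \<subseteq> {q}"
      using that by fastforce+
    thus ?thesis
      unfolding L_def run_words_def using run_small_True_iff[of w q] by blast
  qed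
  hence "L True = {w. set w \<subseteq> {q} \<and> length w = n}"
    by blast
  hence LT: "card (L True) = 1"
    using card_lists_length_eq[of "{q}" n] by simp
  have "critical_words q t n = B False \<union> B True"
    by (auto simp: critical_words_def B_def run_words_def) (metis (full_types))
  moreover have "B False \<inter> B True = {}"
    using run_big_forgets_start by (fastforce simp: B_def run_words_def)
  ultimately have "card (critical_words q t n) = card (B False) + card (B True)"
    using fin by (simp add: card_Un_disjoint)
  thus ?thesis
    using card_closed_run_words[of q t n] split LF LT by simp
qed


section \<open>Critical configurations as words\<close>

text \<open>The entry at the hub and the zeros beyond the rim are those that \<open>config\<close>
  forces, so words of length \<open>k\<close> correspond bijectively to configurations of the
  wheel.\<close>

definition config_of_word :: "nat list \<Rightarrow> nat \<Rightarrow> int" where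
  "config_of_word w v = (if v = 0 then - int (sum_list w)
     else if v \<le> length w then int (w ! (v - 1)) else 0)"

lemma inj_on_config_of_word: "inj_on config_of_word {w. length w = k}"
proof (rule inj_onI)
  fix w u :: "nat list"
  assume len: "w \<in> {w. length w = k}" "u \<in> {w. length w = k}" and eq: "config_of_word w = config_of_word u"
  have "w ! i = u ! i" if "i < k" for i
    using fun_cong[OF eq, of "Suc i"] that len by (simp add: config_of_word_def)
  thus "w = u"
    using len by (simp add: nth_equalityI)
qed

lemma config_wheel_iff:
  "config (wheel k q t) 0 c \<longleftrightarrow> (\<exists>w. length w = k \<and> c = config_of_word w)"
proof -
  have V: "verts (wheel k q t) - {0} = {1..k}"
    by (auto simp: verts_wheel)
  have sum: "(\<Sum>v\<in>{1..k}. config_of_word w v) = int (sum_list w)" if "length w = k" for w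
  proof -
    have "(\<Sum>v\<in>{1..k}. config_of_word w v) = (\<Sum>i<k. config_of_word w (Suc i))"
      by (rule sum.reindex_bij_witness[of _ Suc "\<lambda>v. v - 1"]) auto
    also have "\<dots> = (\<Sum>i<k. int (w ! i))"
      using that by (intro sum.cong) (auto simp: config_of_word_def)
    finally show ?thesis
      using that by (simp add: sum_list_sum_nth atLeast0LessThan)
  qed
  show ?thesis
  proof
    assume c: "config (wheel k q t) 0 c"
    \<comment> \<open>Here \<open>nat\<close> loses nothing, as the rim entries of a configuration
      are nonnegative.\<close>
    define w where "w = map (\<lambda>i. nat (c (Suc i))) [0..<k]"
    have len: "length w = k"
      by (simp add: w_def)
    have rim: "config_of_word w v = c v" if "v \<in> {1..k}" for v
      using that c by (auto simp: config_of_word_def w_def config_def V)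
    have "c 0 = - (\<Sum>v\<in>{1..k}. c v)"
      using c by (simp add: config_def V)
    also have "(\<Sum>v\<in>{1..k}. c v) = (\<Sum>v\<in>{1..k}. config_of_word w v)"
      using rim by (intro sum.cong) auto
    also have "\<dots> = int (sum_list w)"
      by (rule sum[OF len])
    finally have "c v = config_of_word w v" for v
      using rim[of v] c len
      by (cases "v = 0"; cases "v \<le> k") (auto simp: config_of_word_def config_def verts_wheel)
    thus "\<exists>w. length w = k \<and> c = config_of_word w"
      using len by blast
  next
    assume "\<exists>w. length w = k \<and> c = config_of_word w"
    then obtain w where w: "length w = k" "c = config_of_word w"
      by blast
    show "config (wheel k q t) 0 c"
      unfolding config_def V using w sum[OF w(1)]
      by (auto simp: verts_wheel config_of_word_def)
  qed
qed

text \<open>Rim vertices have out-degree \<open>1 + q + t\<close>, so stability becomes the alphabet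
  \<open>{..q + t}\<close>. Through the burning criterion, recurrence becomes a letter exceeding
  \<open>q\<close> together with a closed run.\<close>

lemma critical_config_of_word_iff:
  assumes "t \<ge> 1" "k \<ge> 1" "length w = k"
  shows "critical (wheel k q t) 0 (config_of_word w) \<longleftrightarrow> w \<in> critical_words q t k"
proof -
  have all_rim: "(\<forall>v\<in>{1..k}. P (w ! (v - 1))) \<longleftrightarrow> (\<forall>x\<in>set w. P x)" for P
  proof
    assume *: "\<forall>v\<in>{1..k}. P (w ! (v - 1))"
    show "\<forall>x\<in>set w. P x"
    proof
      fix x assume "x \<in> set w"
      then obtain i where "i < k" "x = w ! i"
        using assms(3) by (auto simp: in_set_conv_nth)
      thus "P x"
        using *[rule_format, of "Suc i"] by simp
    qed
  qed (use assms(3) in auto)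
  have rim: "config_of_word w v = int (w ! (v - 1))" if "v \<in> {1..k}" for v
    using that assms(3) by (auto simp: config_of_word_def)
  have V: "verts (wheel k q t) - {0} = {1..k}"
    by (auto simp: verts_wheel)
  have "stable (wheel k q t) 0 (config_of_word w) \<longleftrightarrow> (\<forall>v\<in>{1..k}. w ! (v - 1) \<le> q + t)"
    unfolding stable_def V
  proof (intro ball_cong refl)
    fix v assume v: "v \<in> {1..k}"
    show "config_of_word w v < int (out_degree (wheel k q t) v) \<longleftrightarrow> w ! (v - 1) \<le> q + t"
      unfolding rim[OF v] out_degree_wheel_rim[OF v] by linarith
  qed
  also have "\<dots> \<longleftrightarrow> set w \<subseteq> {..q + t}"
    unfolding all_rim[of "\<lambda>x. x \<le> q + t"] by auto
  finally have st: "stable (wheel k q t) 0 (config_of_word w) \<longleftrightarrow> set w \<subseteq> {..q + t}" .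
  \<comment> \<open>For \<open>v\<close> and \<open>S\<close> on the rim this is the number of arcs
    from \<open>S\<close> to \<open>v\<close>.\<close>
  define m where "m S v = (if rim_next k v \<in> S then 1 else 0) + (if rim_prev k v \<in> S then q else 0)" for S v
  have "(\<exists>v\<in>S. int (m S v) \<le> config_of_word w v) \<longleftrightarrow> (\<exists>v\<in>S. m S v \<le> w ! (v - 1))"
    if "S \<subseteq> {1..k}" for S
  proof (rule bex_cong[OF refl])
    fix v assume "v \<in> S"
    hence "v \<in> {1..k}"
      using that by blast
    thus "int (m S v) \<le> config_of_word w v \<longleftrightarrow> m S v \<le> w ! (v - 1)"
      by (simp only: rim of_nat_le_iff)
  qed
  hence "(\<forall>S. S \<subseteq> {1..k} \<longrightarrow> S \<noteq> {} \<longrightarrow> (\<exists>v\<in>S. int (m S v) \<le> config_of_word w v)) \<longleftrightarrow>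
      (\<forall>S. S \<subseteq> {1..k} \<longrightarrow> S \<noteq> {} \<longrightarrow> (\<exists>v\<in>S. m S v \<le> w ! (v - 1)))"
    by (simp only: cong: imp_cong)
  moreover have "config (wheel k q t) 0 (config_of_word w)"
    using config_wheel_iff assms(3) by blast
  ultimately have "critical (wheel k q t) 0 (config_of_word w) \<longleftrightarrow> set w \<subseteq> {..q + t} \<and>
    (\<forall>S. S \<subseteq> {1..k} \<longrightarrow> S \<noteq> {} \<longrightarrow> (\<exists>v\<in>S. m S v \<le> w ! (v - 1)))"
    unfolding critical_wheel_iff[OF assms(1)] st m_def by (simp only: simp_thms)
  also have "\<dots> \<longleftrightarrow> set w \<subseteq> {..q + t} \<and> (\<exists>v\<in>{1..k}. w ! (v - 1) > q) \<and> (\<exists>s. run q s w s)"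
    unfolding m_def no_forbidden_iff_closed_run[OF assms(2)] ex_closed_run_iff[OF assms(3,2)] ..
  also have "(\<exists>v\<in>{1..k}. w ! (v - 1) > q) \<longleftrightarrow> (\<exists>x\<in>set w. x > q)"
    using all_rim[of "\<lambda>x. \<not> x > q"] by blast
  finally show ?thesis
    using assms(3) by (simp add: critical_words_def)
qed

theorem theorem4:
  fixes q t k :: nat
  assumes "t \<ge> 1" and "k \<ge> 1"
  shows "int (Coset.order (critical_group (wheel k q t) 0)) = - eval2 (N_poly k) (int q) (- int t)"
proof -
  have "{c. critical (wheel k q t) 0 c} = config_of_word ` critical_words q t k"
  proof (intro equalityI subsetI)
    fix c assume "c \<in> {c. critical (wheel k q t) 0 c}"
    hence c: "critical (wheel k q t) 0 c"
      by simp
    then obtain w where "length w = k" "c = config_of_word w"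
      unfolding critical_def config_wheel_iff by blast
    thus "c \<in> config_of_word ` critical_words q t k"
      using c critical_config_of_word_iff[OF assms] by blast
  next
    fix c assume "c \<in> config_of_word ` critical_words q t k"
    then obtain w where w: "w \<in> critical_words q t k" "c = config_of_word w"
      by blast
    hence "length w = k"
      by (simp add: critical_words_def)
    thus "c \<in> {c. critical (wheel k q t) 0 c}"
      using critical_config_of_word_iff[OF assms] w by blast
  qed
  moreover have "inj_on config_of_word (critical_words q t k)"
    by (rule inj_on_subset[OF inj_on_config_of_word[of k]]) (auto simp: critical_words_def)
  ultimately have "Coset.order (critical_group (wheel k q t) 0) = card (critical_words q t k)"
    by (simp add: Coset.order_def critical_group_def card_image)
  \<comment> \<open>By \<open>N_poly_eq\<close>, the polynomial is \<open>1 + q ^ k\<close> minus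
    \<open>trace_poly k\<close>, so its negative at \<open>x = - t\<close> is the number of critical
    words.\<close>
  thus ?thesis
    by (simp add: card_critical_words N_poly_eq eval2_hom)
qed

end
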